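(* For every positive integer $n$ there exists a bijection between $A(3,n)$ and $W_n$.
   Context: For positive integers $m,n$, let $A(m,n)$ be the set of all $m\times n$ matrices with every entry in $\{1,-1\}$ such that every row sum and every column sum has absolute value at most $1$. Let $W_n$ be the set of walks of $n$ steps on the lattice $\mathbb{Z}^3$ starting at the origin $(0,0,0)$, each step being one of the six unit vectors $(\pm1,0,0),(0,\pm1,0),(0,0,\pm1)$, such that: if $n$ is even, the walk ends at $(0,0,0)$; if $n$ is odd, the walk ends at one of the eight points $(1,0,0),(-1,0,0),(0,1,0),(0,-1,0),(0,0,1),(0,0,-1),(1,1,1),(-1,-1,-1)$. *)

theory Defs
  imports "Jordan_Normal_Form.Matrix" "HOL-Library.Product_Plus"
begin

definition balanced_mats :: "nat \<Rightarrow> nat \<Rightarrow> int mat set" where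
  "balanced_mats m n = {M \<in> carrier_mat m n.
     (\<forall>i<m. \<forall>j<n. M $$ (i, j) \<in> {1, -1}) \<and>
     (\<forall>i<m. \<bar>\<Sum>j<n. M $$ (i, j)\<bar> \<le> 1) \<and>
     (\<forall>j<n. \<bar>\<Sum>i<m. M $$ (i, j)\<bar> \<le> 1)}"

type_synonym point = "int \<times> int \<times> int"

definition unit_vectors :: "point set" where
  "unit_vectors = {(1,0,0), (-1,0,0), (0,1,0), (0,-1,0), (0,0,1), (0,0,-1)}"

definition endpoints :: "nat \<Rightarrow> point set" where
  "endpoints n = (if even n then {(0,0,0)}
     else {(1,0,0), (-1,0,0), (0,1,0), (0,-1,0), (0,0,1), (0,0,-1), (1,1,1), (-1,-1,-1)})"

(* A walk of n steps is the list of the n + 1 points it visits; the difference below is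
   componentwise subtraction of triples. *)
definition walks :: "nat \<Rightarrow> point list set" where
  "walks n = {w. length w = n + 1 \<and> w ! 0 = (0,0,0) \<and>
     (\<forall>k<n. w ! (k + 1) - w ! k \<in> unit_vectors) \<and> w ! n \<in> endpoints n}"

end

theory Submission imports Defs begin

text \<open>
  A balanced column of height 3 is one of the six vectors \<open>\<plusminus>a\<^sub>i\<close>, where
  \<open>a\<^sub>1 = (-1,1,1)\<close>, \<open>a\<^sub>2 = (1,-1,1)\<close>, \<open>a\<^sub>3 = (1,1,-1)\<close>. These three are linearly independent,
  so sending \<open>\<plusminus>a\<^sub>i\<close> to \<open>\<plusminus>e\<^sub>i\<close> turns the columns into the steps of a walk whose endpoint is a
  linear image of the vector of row sums. The row sums have the parity of \<open>n\<close>, so they are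
  bounded by 1 iff they are all 0 (\<open>n\<close> even) or all \<open>\<plusminus>1\<close> (\<open>n\<close> odd), and the preimages of
  these vectors are exactly the prescribed endpoints.
\<close>

text \<open>The linear map sending the basis vector \<open>e\<^sub>i\<close> to \<open>a\<^sub>i\<close>; rows are numbered from 0.\<close>

definition entry :: "nat \<Rightarrow> point \<Rightarrow> int" where
  "entry i p = (case p of (x, y, z) \<Rightarrow> x + y + z - 2 * (if i = 0 then x else if i = 1 then y else z))"

text \<open>The inverse of the map with components \<open>entry 0\<close>, \<open>entry 1\<close>,
  \<open>entry 2\<close>: adding two of these leaves twice one coordinate, so the division is exact
  whenever the three values have equal parity.\<close>

definition step :: "(nat \<Rightarrow> int) \<Rightarrow> point" where
  "step c = ((c 1 + c 2) div 2, (c 0 + c 2) div 2, (c 0 + c 1) div 2)"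

lemma all_less_3: "(\<forall>i<(3::nat). P i) \<longleftrightarrow> P 0 \<and> P 1 \<and> P 2"
  by (auto simp: numeral_3_eq_3 numeral_2_eq_2 less_Suc_eq)

lemma sum_less_3: "(\<Sum>i<(3::nat). f i) = f 0 + f 1 + f 2" for f :: "nat \<Rightarrow> int"
  by (simp add: numeral_3_eq_3 numeral_2_eq_2)

lemma entry_add: "entry i (p + q) = entry i p + entry i q"
  by (cases p; cases q) (simp add: entry_def)

lemma entry_sum: "entry i (\<Sum>j\<in>A. d j) = (\<Sum>j\<in>A. entry i (d j))"
proof (induction A rule: infinite_finite_induct)
  case (insert j A)
  then show ?case by (simp add: entry_add)
qed (simp_all add: entry_def zero_prod_def)

text \<open>The bound on the sum rules out just the two constant sign vectors, of sum 3 and -3. The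
  other six are the images of the unit vectors.\<close>

lemma step_balanced:
  assumes "\<forall>i<3. c i \<in> {1, -1}" and "\<bar>\<Sum>i<3. c i\<bar> \<le> 1"
  shows "step c \<in> unit_vectors" and "\<forall>i<3. entry i (step c) = c i"
proof -
  have c: "c 0 \<in> {1, -1}" "c 1 \<in> {1, -1}" "c 2 \<in> {1, -1}" "\<bar>c 0 + c 1 + c 2\<bar> \<le> 1"
    using assms by (simp_all add: all_less_3 sum_less_3)
  then show "step c \<in> unit_vectors"
    unfolding step_def unit_vectors_def by (elim insertE emptyE) simp_all
  from c show "\<forall>i<3. entry i (step c) = c i"
    unfolding all_less_3 step_def entry_def by (elim insertE emptyE) simp_all
qed

lemma entry_unit_vector:
  assumes "d \<in> unit_vectors"
  shows "\<forall>i<3. entry i d \<in> {1, -1}" and "\<bar>\<Sum>i<3. entry i d\<bar> \<le> 1"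
    and "step (\<lambda>i. entry i d) = d"
proof -
  show "\<forall>i<3. entry i d \<in> {1, -1}"
    using assms unfolding all_less_3 entry_def unit_vectors_def
    by (elim insertE emptyE) simp_all
  show "\<bar>\<Sum>i<3. entry i d\<bar> \<le> 1"
    using assms unfolding sum_less_3 entry_def unit_vectors_def
    by (elim insertE emptyE) simp_all
  show "step (\<lambda>i. entry i d) = d"
    using assms unfolding step_def entry_def unit_vectors_def
    by (elim insertE emptyE) simp_all
qed

text \<open>Each step changes every \<open>entry\<close> by 1 or -1 and so flips its parity.\<close>

lemma even_entry_sum_unit_vectors:
  fixes n :: nat
  assumes "\<forall>j<n. d j \<in> unit_vectors"
  shows "even (entry i (\<Sum>j<n. d j)) \<longleftrightarrow> even n"
  using assms
proof (induction n)
  case (Suc n)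
  have "odd (entry i (d n))"
  proof -
    have "d n \<in> unit_vectors" using Suc.prems by simp
    then show ?thesis by (auto simp: unit_vectors_def entry_def)
  qed
  with Suc show ?case by (simp add: entry_add)
qed (simp add: entry_def zero_prod_def)

text \<open>For odd \<open>n\<close>, parity and the bound leave the eight sign vectors: the two
  constant ones come from (1,1,1) and (-1,-1,-1), the other six from the unit vectors.\<close>

lemma endpoints_iff:
  assumes "\<And>i. even (entry i p) \<longleftrightarrow> even n"
  shows "p \<in> endpoints n \<longleftrightarrow> (\<forall>i<3. \<bar>entry i p\<bar> \<le> 1)"
proof (cases p)
  case (fields x y z)
  define s where "s i = entry i p" for i
  \<comment> \<open>The inversion formula of \<open>step\<close>, now applied to row sums instead of
    a single column.\<close>
  have xyz: "x = (s 1 + s 2) div 2" "y = (s 0 + s 2) div 2" "z = (s 0 + s 1) div 2"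
    by (simp_all add: s_def fields entry_def)
  show ?thesis
  proof
    assume "p \<in> endpoints n"
    then show "\<forall>i<3. \<bar>entry i p\<bar> \<le> 1"
      by (auto simp: endpoints_def all_less_3 entry_def split: if_splits)
  next
    assume "\<forall>i<3. \<bar>entry i p\<bar> \<le> 1"
    then have small: "\<bar>s i\<bar> \<le> 1" if "i < 3" for i
      using that by (simp add: s_def)
    have "s i \<in> (if even n then {0} else {-1, 1})" if "i < 3" for i
    proof -
      have "s i = -1 \<or> s i = 0 \<or> s i = 1"
        using small[OF that] by linarith
      moreover have "even (s i) \<longleftrightarrow> even n"
        using assms by (simp add: s_def)
      ultimately show ?thesis by (elim disjE) simp_all
    qed
    then have s: "s 0 \<in> (if even n then {0} else {-1, 1})"
      "s 1 \<in> (if even n then {0} else {-1, 1})" "s 2 \<in> (if even n then {0} else {-1, 1})"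
      by simp_all
    show "p \<in> endpoints n"
    proof (cases "even n")
      case True
      with s show ?thesis by (simp add: fields xyz endpoints_def)
    next
      case False
      with s have "s 0 \<in> {-1, 1}" "s 1 \<in> {-1, 1}" "s 2 \<in> {-1, 1}" by simp_all
      then have "p \<in> {(1,0,0), (-1,0,0), (0,1,0), (0,-1,0), (0,0,1), (0,0,-1), (1,1,1), (-1,-1,-1)}"
        unfolding fields xyz by (elim insertE emptyE) simp_all
      with False show ?thesis by (simp add: endpoints_def)
    qed
  qed
qed

definition walk_of_mat :: "nat \<Rightarrow> int mat \<Rightarrow> point list" where
  "walk_of_mat n M = map (\<lambda>k. \<Sum>j<k. step (\<lambda>i. M $$ (i, j))) [0..<n + 1]"

definition mat_of_walk :: "nat \<Rightarrow> point list \<Rightarrow> int mat" where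
  "mat_of_walk n w = mat 3 n (\<lambda>(i, j). entry i (w ! (j + 1) - w ! j))"

lemma walk_of_mat_nth:
  "k \<le> n \<Longrightarrow> walk_of_mat n M ! k = (\<Sum>j<k. step (\<lambda>i. M $$ (i, j)))"
  by (simp add: walk_of_mat_def del: upt_Suc)

lemma walk_of_mat_diff:
  "j < n \<Longrightarrow> walk_of_mat n M ! (j + 1) - walk_of_mat n M ! j = step (\<lambda>i. M $$ (i, j))"
  by (simp add: walk_of_mat_nth)

lemma walk_of_mat_in_walks:
  assumes "M \<in> balanced_mats 3 n"
  shows "walk_of_mat n M \<in> walks n"
proof -
  let ?d = "\<lambda>j. step (\<lambda>i. M $$ (i, j))"
  have d: "?d j \<in> unit_vectors" "\<forall>i<3. entry i (?d j) = M $$ (i, j)" if "j < n" for j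
    using step_balanced[of "\<lambda>i. M $$ (i, j)"] assms that by (simp_all add: balanced_mats_def)
  have "\<bar>entry i (\<Sum>j<n. ?d j)\<bar> \<le> 1" if "i < 3" for i
  proof -
    \<comment> \<open>Linearity turns the \<open>entry\<close> of the endpoint into the sum of row
      \<open>i\<close>.\<close>
    have "entry i (\<Sum>j<n. ?d j) = (\<Sum>j<n. M $$ (i, j))"
      unfolding entry_sum using d that by (intro sum.cong) auto
    then show ?thesis using assms that by (simp add: balanced_mats_def)
  qed
  then have "(\<Sum>j<n. ?d j) \<in> endpoints n"
    using d by (subst endpoints_iff) (auto simp: even_entry_sum_unit_vectors)
  then show ?thesis
    using d(1) walk_of_mat_diff[of _ n M]
    by (simp add: walks_def walk_of_mat_nth zero_prod_def) (simp add: walk_of_mat_def)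
qed

lemma walk_nth:
  assumes "w \<in> walks n" and "k \<le> n"
  shows "w ! k = (\<Sum>j<k. w ! (j + 1) - w ! j)"
proof -
  have "w ! 0 = 0"
    using assms by (simp add: walks_def zero_prod_def)
  then show ?thesis
    using sum_lessThan_telescope[of "\<lambda>j. w ! j" k] by simp
qed

lemma mat_of_walk_in_balanced_mats:
  assumes "w \<in> walks n"
  shows "mat_of_walk n w \<in> balanced_mats 3 n"
proof -
  let ?d = "\<lambda>j. w ! (j + 1) - w ! j"
  have d: "?d j \<in> unit_vectors" if "j < n" for j
    using assms that by (simp add: walks_def)
  \<comment> \<open>The steps telescope to the last point, so the endpoint condition becomes a bound
    on row sums.\<close>
  have "(\<Sum>j<n. ?d j) \<in> endpoints n"
    using assms walk_nth[OF assms order_refl] by (simp add: walks_def)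
  then have "\<forall>i<3. \<bar>entry i (\<Sum>j<n. ?d j)\<bar> \<le> 1"
    using d by (subst (asm) endpoints_iff) (auto simp: even_entry_sum_unit_vectors)
  then show ?thesis
    using entry_unit_vector(1,2)[OF d]
    by (simp add: balanced_mats_def mat_of_walk_def entry_sum)
qed

lemma mat_of_walk_of_mat:
  assumes "M \<in> balanced_mats 3 n"
  shows "mat_of_walk n (walk_of_mat n M) = M"
proof (rule eq_matI)
  fix i j assume "i < dim_row M" "j < dim_col M"
  then have "i < 3" "j < n" using assms by (auto simp: balanced_mats_def)
  then show "mat_of_walk n (walk_of_mat n M) $$ (i, j) = M $$ (i, j)"
    using assms step_balanced(2)[of "\<lambda>i. M $$ (i, j)"] walk_of_mat_diff[of j n M]
    by (simp add: mat_of_walk_def balanced_mats_def)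
qed (use assms in \<open>auto simp: mat_of_walk_def balanced_mats_def\<close>)

lemma walk_of_mat_of_walk:
  assumes "w \<in> walks n"
  shows "walk_of_mat n (mat_of_walk n w) = w"
proof (rule nth_equalityI)
  show len: "length (walk_of_mat n (mat_of_walk n w)) = length w"
    using assms by (simp add: walk_of_mat_def walks_def)
  fix k assume "k < length (walk_of_mat n (mat_of_walk n w))"
  then have k: "k \<le> n" by (simp add: walk_of_mat_def)
  have "step (\<lambda>i. mat_of_walk n w $$ (i, j)) = w ! (j + 1) - w ! j" if "j < k" for j
  proof -
    have "w ! (j + 1) - w ! j \<in> unit_vectors"
      using assms that k by (simp add: walks_def)
    from entry_unit_vector(3)[OF this] show ?thesis
      \<comment> \<open>\<open>step\<close> reads its argument only at 0, 1 and 2, which are valid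
        row indices of the matrix.\<close>
      using that k by (simp add: step_def mat_of_walk_def)
  qed
  then show "walk_of_mat n (mat_of_walk n w) ! k = w ! k"
    using walk_nth[OF assms k] by (simp add: walk_of_mat_nth[OF k])
qed

theorem theorem3:
  fixes n :: nat
  assumes "n > 0"
  shows "\<exists>f. bij_betw f (balanced_mats 3 n) (walks n)"
proof
  show "bij_betw (walk_of_mat n) (balanced_mats 3 n) (walks n)"
    by (rule bij_betwI[where g = "mat_of_walk n"])
      (auto simp: walk_of_mat_in_walks mat_of_walk_in_balanced_mats
        mat_of_walk_of_mat walk_of_mat_of_walk)
qed

end
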